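(* Let $r\ge2$ be an integer. There is a constant $c_r>0$ depending only on $r$ such that for every $M\ge2$ and every $H\in\mathscr{H}_M^r$, $H$ is a real-valued smooth map on $\mathbb{C}^{\mathcal{T}_M}$ and $$\forall u\in\mathbb{C}^{\mathcal{T}_M},\quad\|\nabla H(u)\|_{h^{-1/2}}\le c_r(\log M)^{r/2}\,\|H\|_{\mathscr{H}}\,\|u\|_{h^{1/2}}^{r-1}.$$
   Context: $\mathbb{N}=\{0,1,2,\dots\}$, $\langle y\rangle=\sqrt{1+y^2}$. For $M\in(0,\infty)$, $\mathcal{T}_M=\{(\ell,m)\in\mathbb{N}\times\mathbb{Z}:0\le\ell\le M,\ -\ell\le m\le\ell\}$. $\mathbb{C}^{\mathcal{T}_M}$ is viewed as a real Euclidean space with $(u,v)_{\ell^2}=\Re\sum_{k\in\mathcal{T}_M}u_k\overline{v_k}$; $\nabla$ is the gradient for this scalar product; $\|u\|_{h^s}^2=\sum_{k=(\ell,m)\in\mathcal{T}_M}\langle\ell\rangle^{2s}|u_k|^2$. $\mathscr{H}_M^r$ is the space of real-valued homogeneous polynomials of degree $r$ on the real vector space $\mathbb{C}^{\mathcal{T}_M}$. Each $H\in\mathscr{H}_M^r$ is uniquely written $H(u)=\sum_{\sigma\in\{-1,1\}^r}\sum_{\mathbf{k}\in\mathcal{T}_M^r}H_{\mathbf{k}}^\sigma u_{k_1}^{\sigma_1}\cdots u_{k_r}^{\sigma_r}$ (with $u_k^{1}=u_k$, $u_k^{-1}=\overline{u_k}$), where the complex coefficients satisfy $H_{\mathbf{k}}^{-\sigma}=\overline{H_{\mathbf{k}}^\sigma}$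 and are invariant under simultaneous permutation of the entries of $\mathbf{k}$ and $\sigma$. With $k_j=(\ell_j,m_j)$ and $\Upsilon(\mathbf{k})=\max(\{1\}\cup\{\langle\ell_j\rangle:1\le j\le r,\ \forall j'\ne j,\ k_{j'}\ne k_j\})$, $$\|H\|_{\mathscr{H}}=\max_{\sigma\in\{-1,1\}^r}\max_{\mathbf{k}\in\mathcal{T}_M^r}|H_{\mathbf{k}}^\sigma|\sqrt{\langle\ell_1\rangle\cdots\langle\ell_r\rangle}\sqrt{\Upsilon(\mathbf{k})}.$$ *)

theory Defs
  imports "HOL-Analysis.Analysis" "HOL-Analysis.Finite_Function_Topology"
begin

definition japanese :: "real \<Rightarrow> real"  ("\<langle>_\<rangle>") where
  "\<langle>y\<rangle> = sqrt (1 + y\<^sup>2)"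

definition modes :: "real \<Rightarrow> (nat \<times> int) set" where
  "modes M = {(l, m). real l \<le> M \<and> - int l \<le> m \<and> m \<le> int l}"

(* The spaces of complex families indexed by modes M, for varying M, are realised as finite-dimensional
   real subspaces of the finitely supported families on nat \<times> int.  The library norm on that type
   is the l1 norm; on each of these subspaces it is equivalent to the Euclidean one, so that
   continuity and (Frechet) derivatives within the subspace are the usual ones. *)

type_synonym family = "(nat \<times> int) \<Rightarrow>\<^sub>0 complex"

abbreviation entry :: "family \<Rightarrow> nat \<times> int \<Rightarrow> complex" where
  "entry \<equiv> Poly_Mapping.lookup"

definition families :: "real \<Rightarrow> family set" where
  "families M = {u. Poly_Mapping.keys u \<subseteq> modes M}"

definition scalar_prod :: "real \<Rightarrow> family \<Rightarrow> family \<Rightarrow> real" where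
  "scalar_prod M u v = Re (\<Sum>k\<in>modes M. entry u k * cnj (entry v k))"

definition h_norm :: "real \<Rightarrow> real \<Rightarrow> family \<Rightarrow> real" where
  "h_norm M s u = sqrt (\<Sum>k\<in>modes M. \<langle>real (fst k)\<rangle> powr (2 * s) * (cmod (entry u k))\<^sup>2)"

definition gradient :: "real \<Rightarrow> (family \<Rightarrow> real) \<Rightarrow> family \<Rightarrow> family" where
  "gradient M H u =
     (THE g. g \<in> families M \<and> (H has_derivative scalar_prod M g) (at u within families M))"

(* Intended for a finite-dimensional linear subspace S: there the values of the derivative within S
   on vectors of S are unique, and a differentiable f is of class C^(n+1) iff all its
   directional derivatives are of class C^n. *)
primrec Ck_on ::
    "nat \<Rightarrow> 'a::real_normed_vector set \<Rightarrow> ('a \<Rightarrow> 'b::real_normed_vector) \<Rightarrow> bool" where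
  "Ck_on 0 S f \<longleftrightarrow> continuous_on S f"
| "Ck_on (Suc n) S f \<longleftrightarrow>
     f differentiable_on S \<and>
     (\<forall>v\<in>S. Ck_on n S (\<lambda>x. frechet_derivative f (at x within S) v))"

definition smooth_map_on ::
    "'a::real_normed_vector set \<Rightarrow> ('a \<Rightarrow> 'b::real_normed_vector) \<Rightarrow> bool" where
  "smooth_map_on S f \<longleftrightarrow> (\<forall>n. Ck_on n S f)"

(* Pairs of multi-indices of total degree r: exponents of the real coordinates Re u_k and Im u_k. *)
definition real_exponents ::
    "real \<Rightarrow> nat \<Rightarrow> ((nat \<times> int \<Rightarrow> nat) \<times> (nat \<times> int \<Rightarrow> nat)) set" where
  "real_exponents M r =
     {(\<alpha>, \<beta>). (\<forall>k. k \<notin> modes M \<longrightarrow> \<alpha> k = 0 \<and> \<beta> k = 0) \<and> (\<Sum>k\<in>modes M. \<alpha> k + \<beta> k) = r}"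

(* Only the restriction of H to families M is constrained, here and below. *)
definition hom_poly :: "real \<Rightarrow> nat \<Rightarrow> (family \<Rightarrow> real) set" where
  "hom_poly M r =
     {H. \<exists>a. \<forall>u\<in>families M.
        H u = (\<Sum>(\<alpha>, \<beta>)\<in>real_exponents M r.
                 a \<alpha> \<beta> * (\<Prod>k\<in>modes M. Re (entry u k) ^ \<alpha> k * Im (entry u k) ^ \<beta> k))}"

(* r-tuples are functions on {..<r} extended by undefined. *)
definition sign_tuples :: "nat \<Rightarrow> (nat \<Rightarrow> int) set" where
  "sign_tuples r = {..<r} \<rightarrow>\<^sub>E {-1, 1}"

definition mode_tuples :: "real \<Rightarrow> nat \<Rightarrow> (nat \<Rightarrow> nat \<times> int) set" where
  "mode_tuples M r = {..<r} \<rightarrow>\<^sub>E modes M"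

definition conj_sign :: "int \<Rightarrow> complex \<Rightarrow> complex" where
  "conj_sign s z = (if s = 1 then z else cnj z)"

(* The last clause, vanishing outside the index set, makes the coefficient function unique. *)
definition is_coeffs ::
    "real \<Rightarrow> nat \<Rightarrow> (family \<Rightarrow> real) \<Rightarrow>
     ((nat \<Rightarrow> int) \<Rightarrow> (nat \<Rightarrow> nat \<times> int) \<Rightarrow> complex) \<Rightarrow> bool" where
  "is_coeffs M r H c \<longleftrightarrow>
     (\<forall>u\<in>families M. complex_of_real (H u) =
        (\<Sum>\<sigma>\<in>sign_tuples r. \<Sum>k\<in>mode_tuples M r.
           c \<sigma> k * (\<Prod>j<r. conj_sign (\<sigma> j) (entry u (k j))))) \<and>
     (\<forall>\<sigma>\<in>sign_tuples r. \<forall>k\<in>mode_tuples M r.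
        c (\<lambda>j\<in>{..<r}. - \<sigma> j) k = cnj (c \<sigma> k)) \<and>
     (\<forall>\<sigma>\<in>sign_tuples r. \<forall>k\<in>mode_tuples M r. \<forall>p. p permutes {..<r} \<longrightarrow>
        c (\<sigma> \<circ> p) (k \<circ> p) = c \<sigma> k) \<and>
     (\<forall>\<sigma> k. \<sigma> \<notin> sign_tuples r \<or> k \<notin> mode_tuples M r \<longrightarrow> c \<sigma> k = 0)"

definition coeffs_of ::
    "real \<Rightarrow> nat \<Rightarrow> (family \<Rightarrow> real) \<Rightarrow>
     (nat \<Rightarrow> int) \<Rightarrow> (nat \<Rightarrow> nat \<times> int) \<Rightarrow> complex" where
  "coeffs_of M r H = (THE c. is_coeffs M r H c)"

definition Upsilon :: "nat \<Rightarrow> (nat \<Rightarrow> nat \<times> int) \<Rightarrow> real" where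
  "Upsilon r k =
     Max ({1} \<union> {\<langle>real (fst (k j))\<rangle> | j. j < r \<and> (\<forall>j'<r. j' \<noteq> j \<longrightarrow> k j' \<noteq> k j)})"

definition H_norm :: "real \<Rightarrow> nat \<Rightarrow> (family \<Rightarrow> real) \<Rightarrow> real" where
  "H_norm M r H =
     (MAX \<sigma>\<in>sign_tuples r. MAX k\<in>mode_tuples M r.
        cmod (coeffs_of M r H \<sigma> k) * sqrt (\<Prod>j<r. \<langle>real (fst (k j))\<rangle>) * sqrt (Upsilon r k))"

end

theory Submission
  imports Defs
begin

text \<open>
  The estimate is Cauchy-Schwarz, applied slot by slot.  Every coefficient of \<open>H\<close> is at most
  \<open>\<parallel>H\<parallel>\<close> times \<open>(\<langle>l\<^sub>1\<rangle> \<cdots> \<langle>l\<^sub>r\<rangle>) powr (-1/2)\<close>, a product of functions of the single modes.  The derivative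
  \<open>DH(u)[v]\<close> is a sum over the \<open>2 ^ r\<close> sign tuples and over the \<open>r\<close> slots that receive \<open>v\<close>, the other
  slots receiving \<open>u\<close>; with the bound on the coefficients, each summand splits into a product of
  \<open>r\<close> separate sums of \<open>\<langle>l\<rangle> powr (-1/2) * \<bar>w\<^sub>k\<bar>\<close> over the modes, with \<open>w\<close> equal to \<open>u\<close> or \<open>v\<close>
  (\<open>multilinear_sum_le\<close>).  Such a sum is at most the \<open>h\<close>-norm of exponent 1/2 of \<open>w\<close> times the square
  root of the sum of \<open>1 / \<langle>l\<rangle>\<^sup>2\<close> over the modes.  There are \<open>2 * l + 1\<close> modes of degree \<open>l\<close>, so
  this last sum is harmonic and of order \<open>ln M\<close> (\<open>sum_inverse_japanese_squared_le\<close>); the \<open>r\<close> slots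
  give the power \<open>r / 2\<close> of the logarithm.  This bounds \<open>DH(u)\<close> in the dual of the \<open>h\<close>-space of
  exponent 1/2, and the norm of exponent -1/2 of the gradient is exactly that dual norm
  (\<open>h_norm_duality\<close>).

  The argument presupposes that the objects defined by description are the intended ones.
  The gradient is the Riesz representative of the derivative, and derivatives within a subspace
  are unique along it (\<open>gradient_characterization\<close>).  The coefficients exist
  because a real monomial of degree \<open>r\<close> is a product of \<open>r\<close> coordinates, each a combination
  of \<open>u\<^sub>k\<close> and its conjugate; averaging over permutations makes the coefficients symmetric
  (\<open>is_coeffs_symmetrization\<close>).  They are unique because Fourier inversion on a finite group
  recovers them from the values of the polynomial (\<open>symmetric_coefficients_eq_0\<close>).
\<close>

section \<open>Differentiation within a linear subspace\<close>

text \<open>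
  Restricting to the line through \<open>x\<close> in direction \<open>v\<close>, which stays in the subspace, reduces the
  claim to the uniqueness of derivatives of functions of one real variable.
\<close>
lemma has_derivative_within_subspace_unique:
  fixes f :: "'a::real_normed_vector \<Rightarrow> 'b::real_normed_vector"
  assumes S: "subspace S" and "x \<in> S" and "v \<in> S"
    and D: "(f has_derivative D) (at x within S)"
    and D': "(f has_derivative D') (at x within S)"
  shows "D v = D' v"
proof -
  have line: "((\<lambda>t. x + t *\<^sub>R v) has_derivative (\<lambda>t. t *\<^sub>R v)) (at 0)"
    by (auto intro!: derivative_eq_intros)
  have sub: "range (\<lambda>t. x + t *\<^sub>R v) \<subseteq> S"
    using assms by (auto intro: subspace_add subspace_scale)
  have along: "((\<lambda>t. f (x + t *\<^sub>R v)) has_derivative (\<lambda>t. E (t *\<^sub>R v))) (at 0)"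
    if "(f has_derivative E) (at x within S)" for E
    using has_derivative_in_compose[OF line, of f E]
      has_derivative_subset[OF that sub] by simp
  have "(\<lambda>t. D (t *\<^sub>R v)) = (\<lambda>t. D' (t *\<^sub>R v))"
    using has_derivative_unique[OF along[OF D] along[OF D']] .
  from fun_cong[OF this, of 1] show ?thesis by simp
qed

text \<open>
  Directional derivatives of polynomial functions are again polynomial functions, which is what
  lets the recursive definition of the classes \<open>Ck_on\<close> be unrolled to every order.
\<close>
lemma real_polynomial_function_has_derivative:
  assumes "real_polynomial_function f"
  shows "\<exists>f'. (\<forall>x. (f has_derivative f' x) (at x)) \<and>
              (\<forall>v. real_polynomial_function (\<lambda>x. f' x v))"
  using assms
proof (induction f rule: real_polynomial_function.induct)
  case (linear f)
  then show ?case
    by (intro exI[of _ "\<lambda>x. f"]) (auto intro: bounded_linear_imp_has_derivative)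
next
  case (const c)
  show ?case by (intro exI[of _ "\<lambda>x v. 0"]) auto
next
  case (add f g)
  then obtain f' g' where
    "\<forall>x. (f has_derivative f' x) (at x)" "\<forall>v. real_polynomial_function (\<lambda>x. f' x v)"
    "\<forall>x. (g has_derivative g' x) (at x)" "\<forall>v. real_polynomial_function (\<lambda>x. g' x v)"
    by blast
  then show ?case
    by (intro exI[of _ "\<lambda>x v. f' x v + g' x v"]) (auto intro: has_derivative_add)
next
  case (mult f g)
  then obtain f' g' where
    "\<forall>x. (f has_derivative f' x) (at x)" "\<forall>v. real_polynomial_function (\<lambda>x. f' x v)"
    "\<forall>x. (g has_derivative g' x) (at x)" "\<forall>v. real_polynomial_function (\<lambda>x. g' x v)"
    by blast
  with mult.hyps show ?case
    by (intro exI[of _ "\<lambda>x v. f x * g' x v + f' x v * g x"] conjI allI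
        has_derivative_mult real_polynomial_function.intros(3,4)) auto
qed

lemma real_polynomial_function_smooth_map_on:
  assumes S: "subspace S" and p: "real_polynomial_function p" and eq: "\<And>x. x \<in> S \<Longrightarrow> f x = p x"
  shows "smooth_map_on S f"
  unfolding smooth_map_on_def
proof
  fix n
  show "Ck_on n S f"
    using p eq
  proof (induction n arbitrary: f p)
    case 0
    have "continuous_on S p"
      using real_polynomial_function_has_derivative[OF 0(1)]
      by (metis continuous_at_imp_continuous_on has_derivative_continuous)
    then show ?case
      using 0(2) by (auto cong: continuous_on_cong)
  next
    case (Suc n)
    from real_polynomial_function_has_derivative[OF Suc.prems(1)]
    obtain p' where p': "\<And>x. (p has_derivative p' x) (at x)"
      and poly: "\<And>v. real_polynomial_function (\<lambda>x. p' x v)" by blast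
    have D: "(f has_derivative p' x) (at x within S)" if "x \<in> S" for x
      using that Suc.prems(2) has_derivative_at_withinI[OF p'] by (rule has_derivative_transform)
    have "frechet_derivative f (at x within S) v = p' x v" if "x \<in> S" "v \<in> S" for x v
      using D[OF that(1)] that
      by (intro has_derivative_within_subspace_unique[OF S that(1,2)])
         (auto simp: differentiable_def frechet_derivative_works[symmetric])
    moreover have "f differentiable_on S"
      using D by (auto simp: differentiable_on_def differentiable_def)
    ultimately show ?case
      using Suc.IH[OF poly] by simp
  qed
qed

section \<open>The Euclidean space of families\<close>
lemma finite_modes: "finite (modes M)"
proof (rule finite_subset)
  show "modes M \<subseteq> Sigma {..nat \<lfloor>M\<rfloor>} (\<lambda>l. {- int l..int l})"
    by (auto simp: modes_def le_nat_floor)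
qed auto

lemma entry_scaleR: "entry (a *\<^sub>R u) k = a *\<^sub>R entry u k"
proof -
  have "finite {k. a *\<^sub>R entry u k \<noteq> 0}"
    by (rule finite_subset[OF _ finite_keys[of u]]) (auto simp: in_keys_iff)
  then show ?thesis
    by (simp add: scaleR_poly_mapping_def)
qed

lemma norm_entry_le: "norm (entry u k) \<le> norm u"
proof (cases "k \<in> Poly_Mapping.keys u")
  case True
  have "norm u = (\<Sum>n\<in>Poly_Mapping.keys u. norm (entry u n))"
    by (simp add: norm_poly_mapping_def dist_poly_mapping_def)
  then show ?thesis
    using True member_le_sum[of k "Poly_Mapping.keys u" "\<lambda>n. norm (entry u n)"] by simp
qed (simp add: in_keys_iff)

lemma bounded_linear_entry: "bounded_linear (\<lambda>u. entry u k)"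
  by (rule bounded_linear_intro[where K = 1]) (auto simp: lookup_add entry_scaleR norm_entry_le)

lemma mem_families_iff: "u \<in> families M \<longleftrightarrow> (\<forall>k. k \<notin> modes M \<longrightarrow> entry u k = 0)"
  by (auto simp: families_def in_keys_iff)

lemma subspace_families: "subspace (families M)"
  by (auto simp: subspace_def mem_families_iff lookup_add entry_scaleR)

definition family_of :: "real \<Rightarrow> (nat \<times> int \<Rightarrow> complex) \<Rightarrow> family" where
  "family_of M f = (\<Sum>k\<in>modes M. Poly_Mapping.single k (f k))"

lemma entry_family_of: "entry (family_of M f) k = (if k \<in> modes M then f k else 0)"
  by (simp add: family_of_def lookup_sum lookup_single when_def finite_modes)

lemma family_of_in_families: "family_of M f \<in> families M"
  by (simp add: mem_families_iff entry_family_of)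

lemma family_of_entry: "u \<in> families M \<Longrightarrow> family_of M (entry u) = u"
  by (intro poly_mapping_eqI) (auto simp: mem_families_iff entry_family_of)

lemma bounded_linear_scalar_prod: "bounded_linear (scalar_prod M g)"
  unfolding scalar_prod_def
  by (intro bounded_linear_compose[OF bounded_linear_Re] bounded_linear_sum
      bounded_linear_const_mult bounded_linear_compose[OF bounded_linear_cnj] bounded_linear_entry)

lemma scalar_prod_nondegenerate:
  assumes "g \<in> families M" "h \<in> families M"
    and eq: "\<And>v. v \<in> families M \<Longrightarrow> scalar_prod M g v = scalar_prod M h v"
  shows "g = h"
proof (rule poly_mapping_eqI)
  fix k
  define v where "v = family_of M (\<lambda>k. entry g k - entry h k)"
  have "(\<Sum>k\<in>modes M. (cmod (entry g k - entry h k))\<^sup>2) = scalar_prod M g v - scalar_prod M h v"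
    unfolding scalar_prod_def minus_complex.simps[symmetric] sum_subtractf[symmetric] Re_sum
    by (intro sum.cong)
       (simp_all only: v_def entry_family_of if_True cmod_power2, simp_all add: power2_eq_square algebra_simps)
  then have "(\<Sum>k\<in>modes M. (cmod (entry g k - entry h k))\<^sup>2) = 0"
    using eq[of v] by (simp add: v_def family_of_in_families)
  then show "entry g k = entry h k"
    using assms(1,2) finite_modes[of M]
    by (cases k; cases "k \<in> modes M") (simp_all add: sum_nonneg_eq_0_iff mem_families_iff)
qed

text \<open>
  The Riesz representative: testing \<open>D\<close> on the basis vectors with entry 1 and with entry
  \<open>\<i>\<close> at the mode \<open>k\<close> gives the real and the imaginary part of its entry at \<open>k\<close>.
\<close>
lemma scalar_prod_representation:
  assumes "bounded_linear D"
  obtains g where "g \<in> families M" "\<And>v. v \<in> families M \<Longrightarrow> D v = scalar_prod M g v"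
proof
  interpret D: bounded_linear D by fact
  let ?e = "\<lambda>k z. Poly_Mapping.single k z :: family"
  define g where
    "g = family_of M (\<lambda>k. Complex (D (?e k 1)) (D (?e k \<i>)))"
  show "g \<in> families M" by (simp add: g_def family_of_in_families)
  fix v assume v: "v \<in> families M"
  have single: "?e k z = Re z *\<^sub>R ?e k 1 + Im z *\<^sub>R ?e k \<i>" for k z
    by (intro poly_mapping_eqI)
       (auto simp: lookup_add entry_scaleR lookup_single when_def complex_eq_iff)
  have "D v = D (\<Sum>k\<in>modes M. ?e k (entry v k))"
    using family_of_entry[OF v] by (simp add: family_of_def)
  also have "\<dots> = (\<Sum>k\<in>modes M. Re (entry v k) * D (?e k 1) + Im (entry v k) * D (?e k \<i>))"
    unfolding D.sum by (subst single) (simp add: D.add D.scaleR)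
  also have "\<dots> = scalar_prod M g v"
    unfolding scalar_prod_def Re_sum
    by (intro sum.cong) (auto simp: g_def entry_family_of)
  finally show "D v = scalar_prod M g v" .
qed

text \<open>
  A derivative \<open>D\<close> within the space of families may differ from the scalar product with its
  representative outside that space; the difference quotients inside the space see no difference,
  so the scalar product is a derivative as well.
\<close>
lemma gradient_characterization:
  assumes u: "u \<in> families M" and D: "(H has_derivative D) (at u within families M)"
  shows "gradient M H u \<in> families M"
    and "\<And>v. v \<in> families M \<Longrightarrow> scalar_prod M (gradient M H u) v = D v"
proof -
  obtain g where g: "g \<in> families M"
    and Dg: "\<And>v. v \<in> families M \<Longrightarrow> D v = scalar_prod M g v"
    using scalar_prod_representation[OF has_derivative_bounded_linear[OF D]] by blast
  have Hg: "(H has_derivative scalar_prod M g) (at u within families M)"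
  proof -
    have "((\<lambda>y. (H y - (H u + D (y - u))) / norm (y - u)) \<longlongrightarrow> 0) (at u within families M)
        \<longleftrightarrow> ((\<lambda>y. (H y - (H u + scalar_prod M g (y - u))) / norm (y - u)) \<longlongrightarrow> 0)
              (at u within families M)"
      by (intro Lim_cong_within) (auto simp: Dg u subspace_diff[OF subspace_families])
    then show ?thesis
      using D bounded_linear_scalar_prod[of M g] unfolding has_derivative_within by simp
  qed
  have "gradient M H u = g"
    unfolding gradient_def
  proof (rule the_equality)
    fix h assume h: "h \<in> families M \<and> (H has_derivative scalar_prod M h) (at u within families M)"
    show "h = g"
    proof (rule scalar_prod_nondegenerate)
      fix v assume "v \<in> families M"
      then show "scalar_prod M h v = scalar_prod M g v"
        using has_derivative_within_subspace_unique[OF subspace_families u _ conjunct2[OF h] Hg]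
        by simp
    qed (use h g in auto)
  qed (use g Hg in simp)
  then show "gradient M H u \<in> families M"
    and "\<And>v. v \<in> families M \<Longrightarrow> scalar_prod M (gradient M H u) v = D v"
    using g Dg by auto
qed

section \<open>Existence of the coefficients\<close>
lemma tuple_comp_in_PiE:
  assumes "p permutes A" "f \<in> A \<rightarrow>\<^sub>E B"
  shows "f \<circ> p \<in> A \<rightarrow>\<^sub>E B"
  using assms permutes_in_image[OF assms(1)] permutes_not_in[OF assms(1)]
  by (fastforce simp: PiE_iff extensional_def)

lemma bij_betw_comp_permutes:
  assumes p: "p permutes A"
  shows "bij_betw (\<lambda>f. f \<circ> p) (A \<rightarrow>\<^sub>E B) (A \<rightarrow>\<^sub>E B)"
proof (rule bij_betw_byWitness[where f' = "\<lambda>f. f \<circ> inv p"])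
  show "(\<lambda>f. f \<circ> p) ` (A \<rightarrow>\<^sub>E B) \<subseteq> A \<rightarrow>\<^sub>E B"
    using tuple_comp_in_PiE[OF p] by blast
  show "(\<lambda>f. f \<circ> inv p) ` (A \<rightarrow>\<^sub>E B) \<subseteq> A \<rightarrow>\<^sub>E B"
    using tuple_comp_in_PiE[OF permutes_inv[OF p]] by blast
qed (simp_all add: comp_assoc permutes_inv_o[OF p])

lemma finite_sign_tuples: "finite (sign_tuples r)"
  by (simp add: sign_tuples_def finite_PiE)

lemma finite_mode_tuples: "finite (mode_tuples M r)"
  by (simp add: mode_tuples_def finite_PiE finite_modes)

lemma negated_sign_tuple:
  "\<sigma> \<in> sign_tuples r \<Longrightarrow> (\<lambda>j\<in>{..<r}. - \<sigma> j) \<in> sign_tuples r"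
  by (auto simp: sign_tuples_def PiE_iff)

lemma finite_real_exponents: "finite (real_exponents M r)"
proof -
  define F where
    "F = {f :: nat \<times> int \<Rightarrow> nat. \<forall>k. (k \<in> modes M \<longrightarrow> f k \<in> {..r}) \<and> (k \<notin> modes M \<longrightarrow> f k = 0)}"
  have "real_exponents M r \<subseteq> F \<times> F"
  proof (intro subrelI)
    fix \<alpha> \<beta> assume e: "(\<alpha>, \<beta>) \<in> real_exponents M r"
    have "\<alpha> k + \<beta> k \<le> r" if "k \<in> modes M" for k
      using e that member_le_sum[of k "modes M" "\<lambda>k. \<alpha> k + \<beta> k"] finite_modes[of M]
      by (simp add: real_exponents_def)
    with e show "(\<alpha>, \<beta>) \<in> F \<times> F"
      by (fastforce simp: real_exponents_def F_def)
  qed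
  then show ?thesis
    by (rule finite_subset) (unfold F_def, intro finite_cartesian_product finite_set_of_finite_funs
        finite_modes finite_atMost)
qed

text \<open>
  These are the formulas \<open>Re z = (z + cnj z) / 2\<close> and \<open>Im z = (z - cnj z) / (2 * \<i>)\<close>.  The condition
  on \<open>b (- s)\<close> records that the form is real; it is stable under products and sums and
  becomes the conjugation symmetry of the coefficients.
\<close>
lemma real_coordinate_as_conj_sign_sum:
  fixes f :: "('k \<Rightarrow> complex) \<Rightarrow> real"
  assumes "finite K" and "f \<in> (\<lambda>k u. Re (u k)) ` K \<union> (\<lambda>k u. Im (u k)) ` K"
  shows "\<exists>b. (\<forall>s\<in>{-1, 1}. \<forall>k. b (- s) k = cnj (b s k)) \<and>
             (\<forall>u. complex_of_real (f u) = (\<Sum>s\<in>{-1, 1}. \<Sum>k\<in>K. b s k * conj_sign s (u k)))"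
  using assms(2)
proof (elim UnE imageE)
  fix k assume "f = (\<lambda>u. Re (u k))" "k \<in> K"
  with assms(1) show ?thesis
    by (intro exI[of _ "\<lambda>s k'. if k' = k then 1 / 2 else 0"])
       (auto simp: conj_sign_def if_distrib[of "\<lambda>x. x * _"] complex_eq_iff cong: if_cong)
next
  fix k assume "f = (\<lambda>u. Im (u k))" "k \<in> K"
  with assms(1) show ?thesis
    by (intro exI[of _ "\<lambda>s k'. if k' = k then - \<i> * of_int s / 2 else 0"])
       (auto simp: conj_sign_def if_distrib[of "\<lambda>x. x * _"] complex_eq_iff cong: if_cong)
qed

lemma monomial_as_prod_list:
  fixes \<alpha> \<beta> :: "'k \<Rightarrow> nat"
  assumes "finite K"
  shows "\<exists>fs. length fs = (\<Sum>k\<in>K. \<alpha> k + \<beta> k) \<and>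
     set fs \<subseteq> (\<lambda>k u. Re (u k)) ` K \<union> (\<lambda>k u. Im (u k)) ` K \<and>
     (\<forall>u. (\<Prod>k\<in>K. Re (u k) ^ \<alpha> k * Im (u k) ^ \<beta> k) = prod_list (map (\<lambda>f. f u) fs))"
  using assms
proof (induction K)
  case (insert k K)
  then obtain fs where "length fs = (\<Sum>k\<in>K. \<alpha> k + \<beta> k)"
    "set fs \<subseteq> (\<lambda>k u. Re (u k)) ` K \<union> (\<lambda>k u. Im (u k)) ` K"
    "\<forall>u. (\<Prod>k\<in>K. Re (u k) ^ \<alpha> k * Im (u k) ^ \<beta> k) = prod_list (map (\<lambda>f. f u) fs)"
    by blast
  with insert.hyps show ?case
    by (intro exI[of _ "replicate (\<alpha> k) (\<lambda>u. Re (u k)) @ replicate (\<beta> k) (\<lambda>u. Im (u k)) @ fs"])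
       (auto simp: map_replicate_const prod_list_replicate mult.assoc)
qed auto

text \<open>
  A monomial of degree \<open>r\<close> is the product of a list of \<open>r\<close> coordinates.  Replacing each of them by its
  expression in \<open>u\<^sub>k\<close> and its conjugate and multiplying out gives one term for each choice
  of a sign and a mode in every factor, that is, for each pair of tuples.
\<close>
lemma real_monomial_as_conj_sign_polynomial:
  assumes "(\<alpha>, \<beta>) \<in> real_exponents M r"
  shows "\<exists>d. (\<forall>\<sigma>\<in>sign_tuples r. \<forall>k. d (\<lambda>j\<in>{..<r}. - \<sigma> j) k = cnj (d \<sigma> k)) \<and>
     (\<forall>u. complex_of_real (\<Prod>k\<in>modes M. Re (u k) ^ \<alpha> k * Im (u k) ^ \<beta> k) =
        (\<Sum>\<sigma>\<in>sign_tuples r. \<Sum>k\<in>mode_tuples M r. d \<sigma> k * (\<Prod>j<r. conj_sign (\<sigma> j) (u (k j)))))"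
proof -
  let ?L = "(\<lambda>k u. Re (u k)) ` modes M \<union> (\<lambda>k u. Im (u k)) ` modes M
            :: ((nat \<times> int \<Rightarrow> complex) \<Rightarrow> real) set"
  have deg: "(\<Sum>k\<in>modes M. \<alpha> k + \<beta> k) = r"
    using assms by (simp add: real_exponents_def)
  obtain fs where len: "length fs = r" and fs: "set fs \<subseteq> ?L"
    and mono: "\<And>u. (\<Prod>k\<in>modes M. Re (u k) ^ \<alpha> k * Im (u k) ^ \<beta> k) = prod_list (map (\<lambda>f. f u) fs)"
    using monomial_as_prod_list[OF finite_modes, of \<alpha> \<beta> M] deg by auto
  have "\<exists>b. (\<forall>s\<in>{-1, 1}. \<forall>k. b (- s) k = cnj (b s k)) \<and>
         (\<forall>u. complex_of_real ((fs ! j) u) =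
            (\<Sum>s\<in>{-1, 1}. \<Sum>k\<in>modes M. b s k * conj_sign s (u k)))" if "j < r" for j
    using that fs len nth_mem[of j fs]
    by (intro real_coordinate_as_conj_sign_sum finite_modes) blast
  then have "\<forall>j. \<exists>b. j < r \<longrightarrow> (\<forall>s\<in>{-1, 1}. \<forall>k. b (- s) k = cnj (b s k)) \<and>
         (\<forall>u. complex_of_real ((fs ! j) u) =
            (\<Sum>s\<in>{-1, 1}. \<Sum>k\<in>modes M. b s k * conj_sign s (u k)))" by blast
  from choice[OF this] obtain b where
    herm: "\<And>j s k. j < r \<Longrightarrow> s \<in> {-1, 1} \<Longrightarrow> b j (- s) k = cnj (b j s k)" and
    b: "\<And>j u. j < r \<Longrightarrow> complex_of_real ((fs ! j) u) =
          (\<Sum>s\<in>{-1, 1}. \<Sum>k\<in>modes M. b j s k * conj_sign s (u k))"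
    by blast
  show ?thesis
  proof (intro exI[of _ "\<lambda>\<sigma> k. \<Prod>j<r. b j (\<sigma> j) (k j)"] conjI ballI allI)
    fix \<sigma> k assume "\<sigma> \<in> sign_tuples r"
    then have "\<sigma> j \<in> {-1, 1}" if "j < r" for j
      using that by (auto simp: sign_tuples_def PiE_iff)
    then show "(\<Prod>j<r. b j ((\<lambda>j\<in>{..<r}. - \<sigma> j) j) (k j)) = cnj (\<Prod>j<r. b j (\<sigma> j) (k j))"
      unfolding cnj_prod by (intro prod.cong) (auto simp: herm)
  next
    fix u :: "nat \<times> int \<Rightarrow> complex"
    have "complex_of_real (\<Prod>k\<in>modes M. Re (u k) ^ \<alpha> k * Im (u k) ^ \<beta> k)
        = (\<Prod>j<r. complex_of_real ((fs ! j) u))"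
      by (simp add: mono prod.list_conv_set_nth len atLeast0LessThan flip: of_real_prod)
    also have "\<dots> = (\<Prod>j<r. \<Sum>s\<in>{-1, 1}. \<Sum>k\<in>modes M. b j s k * conj_sign s (u k))"
      by (intro prod.cong) (auto simp: b)
    also have "\<dots> = (\<Sum>\<sigma>\<in>sign_tuples r. \<Prod>j<r. \<Sum>k\<in>modes M. b j (\<sigma> j) k * conj_sign (\<sigma> j) (u k))"
      unfolding sign_tuples_def by (intro prod_sum_PiE) auto
    also have "\<dots> = (\<Sum>\<sigma>\<in>sign_tuples r. \<Sum>k\<in>mode_tuples M r.
                      \<Prod>j<r. b j (\<sigma> j) (k j) * conj_sign (\<sigma> j) (u (k j)))"
      unfolding mode_tuples_def by (intro sum.cong refl prod_sum_PiE) (auto simp: finite_modes)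
    finally show "complex_of_real (\<Prod>k\<in>modes M. Re (u k) ^ \<alpha> k * Im (u k) ^ \<beta> k) =
        (\<Sum>\<sigma>\<in>sign_tuples r. \<Sum>k\<in>mode_tuples M r.
           (\<Prod>j<r. b j (\<sigma> j) (k j)) * (\<Prod>j<r. conj_sign (\<sigma> j) (u (k j))))"
      by (simp add: prod.distrib)
  qed
qed

lemma sum_swap_innermost:
  "(\<Sum>a\<in>A. \<Sum>b\<in>B. \<Sum>c\<in>C. f a b c) = (\<Sum>c\<in>C. \<Sum>a\<in>A. \<Sum>b\<in>B. f a b c)"
proof -
  have "(\<Sum>b\<in>B. \<Sum>c\<in>C. f a b c) = (\<Sum>c\<in>C. \<Sum>b\<in>B. f a b c)" for a
    by (rule sum.swap)
  then show ?thesis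
    by (simp only:) (rule sum.swap)
qed

lemma hom_poly_as_conj_sign_polynomial:
  assumes "H \<in> hom_poly M r"
  obtains d where
    "\<And>\<sigma> k. \<sigma> \<in> sign_tuples r \<Longrightarrow> d (\<lambda>j\<in>{..<r}. - \<sigma> j) k = cnj (d \<sigma> k)"
    "\<And>u. u \<in> families M \<Longrightarrow> complex_of_real (H u) =
       (\<Sum>\<sigma>\<in>sign_tuples r. \<Sum>k\<in>mode_tuples M r.
          d \<sigma> k * (\<Prod>j<r. conj_sign (\<sigma> j) (entry u (k j))))"
proof -
  obtain a where a: "\<And>u. u \<in> families M \<Longrightarrow> H u = (\<Sum>(\<alpha>, \<beta>)\<in>real_exponents M r.
      a \<alpha> \<beta> * (\<Prod>k\<in>modes M. Re (entry u k) ^ \<alpha> k * Im (entry u k) ^ \<beta> k))"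
    using assms by (auto simp: hom_poly_def)
  have "\<forall>e\<in>real_exponents M r. \<exists>d.
      (\<forall>\<sigma>\<in>sign_tuples r. \<forall>k. d (\<lambda>j\<in>{..<r}. - \<sigma> j) k = cnj (d \<sigma> k)) \<and>
      (\<forall>u. complex_of_real (\<Prod>k\<in>modes M. Re (u k) ^ fst e k * Im (u k) ^ snd e k) =
        (\<Sum>\<sigma>\<in>sign_tuples r. \<Sum>k\<in>mode_tuples M r. d \<sigma> k * (\<Prod>j<r. conj_sign (\<sigma> j) (u (k j)))))"
    by (intro ballI real_monomial_as_conj_sign_polynomial) simp
  from bchoice[OF this] obtain d where
    herm: "\<And>e \<sigma> k. e \<in> real_exponents M r \<Longrightarrow> \<sigma> \<in> sign_tuples r \<Longrightarrow>
        d e (\<lambda>j\<in>{..<r}. - \<sigma> j) k = cnj (d e \<sigma> k)"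
    and d: "\<And>e u. e \<in> real_exponents M r \<Longrightarrow>
      complex_of_real (\<Prod>k\<in>modes M. Re (u k) ^ fst e k * Im (u k) ^ snd e k) =
        (\<Sum>\<sigma>\<in>sign_tuples r. \<Sum>k\<in>mode_tuples M r.
           d e \<sigma> k * (\<Prod>j<r. conj_sign (\<sigma> j) (u (k j))))"
    by blast
  let ?D = "\<lambda>\<sigma> k. \<Sum>e\<in>real_exponents M r. complex_of_real (a (fst e) (snd e)) * d e \<sigma> k"
  show thesis
  proof (rule that[of ?D])
    fix \<sigma> k assume "\<sigma> \<in> sign_tuples r"
    then show "?D (\<lambda>j\<in>{..<r}. - \<sigma> j) k = cnj (?D \<sigma> k)"
      unfolding cnj_sum by (intro sum.cong) (auto simp: herm)
  next
    fix u assume u: "u \<in> families M"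
    let ?P = "\<lambda>\<sigma> k. \<Prod>j<r. conj_sign (\<sigma> j) (entry u (k j))"
    have "complex_of_real (H u) = (\<Sum>e\<in>real_exponents M r. complex_of_real (a (fst e) (snd e)) *
        complex_of_real (\<Prod>k\<in>modes M. Re (entry u k) ^ fst e k * Im (entry u k) ^ snd e k))"
      by (simp add: a[OF u] case_prod_unfold)
    also have "\<dots> = (\<Sum>e\<in>real_exponents M r.
        \<Sum>\<sigma>\<in>sign_tuples r. \<Sum>k\<in>mode_tuples M r. complex_of_real (a (fst e) (snd e)) * d e \<sigma> k * ?P \<sigma> k)"
      by (rule sum.cong[OF refl]) (simp only: d sum_distrib_left mult.assoc)
    also have "\<dots> = (\<Sum>\<sigma>\<in>sign_tuples r. \<Sum>k\<in>mode_tuples M r. ?D \<sigma> k * ?P \<sigma> k)"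
      unfolding sum_distrib_right by (rule sum_swap_innermost[symmetric])
    finally show "complex_of_real (H u) =
      (\<Sum>\<sigma>\<in>sign_tuples r. \<Sum>k\<in>mode_tuples M r. ?D \<sigma> k * ?P \<sigma> k)" .
  qed
qed

text \<open>
  The monomial belonging to a pair of tuples is invariant under simultaneous permutation
  of both tuples, so averaging the coefficients over all permutations does not change the function.
\<close>
lemma is_coeffs_symmetrization:
  assumes herm: "\<And>\<sigma> k. \<sigma> \<in> sign_tuples r \<Longrightarrow> d (\<lambda>j\<in>{..<r}. - \<sigma> j) k = cnj (d \<sigma> k)"
    and H: "\<And>u. u \<in> families M \<Longrightarrow> complex_of_real (H u) =
       (\<Sum>\<sigma>\<in>sign_tuples r. \<Sum>k\<in>mode_tuples M r.
          d \<sigma> k * (\<Prod>j<r. conj_sign (\<sigma> j) (entry u (k j))))"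
  shows "is_coeffs M r H (\<lambda>\<sigma> k. if \<sigma> \<in> sign_tuples r \<and> k \<in> mode_tuples M r
           then (\<Sum>p | p permutes {..<r}. d (\<sigma> \<circ> p) (k \<circ> p)) / fact r else 0)"
    (is "is_coeffs M r H ?c")
proof -
  let ?perms = "{p. p permutes {..<r}}"
  have sign_comp: "\<sigma> \<circ> p \<in> sign_tuples r" if "p permutes {..<r}" "\<sigma> \<in> sign_tuples r" for p \<sigma>
    using that unfolding sign_tuples_def by (rule tuple_comp_in_PiE)
  have mode_comp: "k \<circ> p \<in> mode_tuples M r" if "p permutes {..<r}" "k \<in> mode_tuples M r" for p k
    using that unfolding mode_tuples_def by (rule tuple_comp_in_PiE)
  have expansion: "complex_of_real (H u) = (\<Sum>\<sigma>\<in>sign_tuples r. \<Sum>k\<in>mode_tuples M r.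
           ?c \<sigma> k * (\<Prod>j<r. conj_sign (\<sigma> j) (entry u (k j))))" if u: "u \<in> families M" for u
  proof -
    let ?P = "\<lambda>\<sigma> k. \<Prod>j<r. conj_sign (\<sigma> j) (entry u (k j))"
    have permuted: "(\<Sum>\<sigma>\<in>sign_tuples r. \<Sum>k\<in>mode_tuples M r. d (\<sigma> \<circ> p) (k \<circ> p) * ?P \<sigma> k)
          = complex_of_real (H u)" if p: "p permutes {..<r}" for p
    proof -
      have P: "?P \<sigma> k = ?P (\<sigma> \<circ> p) (k \<circ> p)" for \<sigma> k
        using prod.permute[OF p, of "\<lambda>j. conj_sign (\<sigma> j) (entry u (k j))"] by (simp add: o_def)
      have "(\<Sum>\<sigma>\<in>sign_tuples r. \<Sum>k\<in>mode_tuples M r. d (\<sigma> \<circ> p) (k \<circ> p) * ?P \<sigma> k)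
          = (\<Sum>\<sigma>\<in>sign_tuples r. \<Sum>k\<in>mode_tuples M r.
               d (\<sigma> \<circ> p) (k \<circ> p) * ?P (\<sigma> \<circ> p) (k \<circ> p))"
        using P by simp
      also have "\<dots> = (\<Sum>\<sigma>\<in>sign_tuples r. \<Sum>k\<in>mode_tuples M r. d (\<sigma> \<circ> p) k * ?P (\<sigma> \<circ> p) k)"
        unfolding mode_tuples_def
        by (rule sum.cong[OF refl])
           (rule sum.reindex_bij_betw[OF bij_betw_comp_permutes[OF p],
              where g = "\<lambda>k. d (_ \<circ> p) k * ?P (_ \<circ> p) k"])
      also have "\<dots> = (\<Sum>\<sigma>\<in>sign_tuples r. \<Sum>k\<in>mode_tuples M r. d \<sigma> k * ?P \<sigma> k)"
        unfolding sign_tuples_def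
        by (rule sum.reindex_bij_betw[OF bij_betw_comp_permutes[OF p],
              where g = "\<lambda>\<sigma>. \<Sum>k\<in>mode_tuples M r. d \<sigma> k * ?P \<sigma> k"])
      finally show ?thesis using H[OF u] by simp
    qed
    have "(\<Sum>\<sigma>\<in>sign_tuples r. \<Sum>k\<in>mode_tuples M r. ?c \<sigma> k * ?P \<sigma> k)
        = (\<Sum>\<sigma>\<in>sign_tuples r. \<Sum>k\<in>mode_tuples M r. \<Sum>p\<in>?perms.
             d (\<sigma> \<circ> p) (k \<circ> p) * ?P \<sigma> k) / fact r"
      by (simp add: sum_distrib_right sum_divide_distrib)
    also have "(\<Sum>\<sigma>\<in>sign_tuples r. \<Sum>k\<in>mode_tuples M r. \<Sum>p\<in>?perms.
             d (\<sigma> \<circ> p) (k \<circ> p) * ?P \<sigma> k)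
        = (\<Sum>p\<in>?perms. \<Sum>\<sigma>\<in>sign_tuples r. \<Sum>k\<in>mode_tuples M r. d (\<sigma> \<circ> p) (k \<circ> p) * ?P \<sigma> k)"
      by (rule sum_swap_innermost)
    also have "\<dots> = of_nat (card ?perms) * complex_of_real (H u)"
      by (simp add: permuted)
    also have "\<dots> / fact r = complex_of_real (H u)"
      by (simp add: card_permutations[of "{..<r}" r])
    finally show ?thesis by simp
  qed
  have conj: "?c (\<lambda>j\<in>{..<r}. - \<sigma> j) k = cnj (?c \<sigma> k)"
    if \<sigma>: "\<sigma> \<in> sign_tuples r" and k: "k \<in> mode_tuples M r" for \<sigma> k
  proof -
    have "(\<lambda>j\<in>{..<r}. - \<sigma> j) \<circ> p = (\<lambda>j\<in>{..<r}. - (\<sigma> \<circ> p) j)" if "p permutes {..<r}" for p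
      using permutes_in_image[OF that] by (auto simp: fun_eq_iff)
    then have neg: "d ((\<lambda>j\<in>{..<r}. - \<sigma> j) \<circ> p) (k \<circ> p) = cnj (d (\<sigma> \<circ> p) (k \<circ> p))"
      if "p permutes {..<r}" for p
      using that herm[OF sign_comp[OF that \<sigma>]] by (simp del: o_apply)
    then show ?thesis
      using \<sigma> k by (auto simp: negated_sign_tuple intro!: sum.cong neg)
  qed
  have sym: "?c (\<sigma> \<circ> q) (k \<circ> q) = ?c \<sigma> k"
    if \<sigma>: "\<sigma> \<in> sign_tuples r" and k: "k \<in> mode_tuples M r" and q: "q permutes {..<r}" for \<sigma> k q
    using \<sigma> k setum_permutations_compose_left[OF q, of "\<lambda>p. d (\<sigma> \<circ> p) (k \<circ> p)"]
    by (simp add: sign_comp[OF q] mode_comp[OF q] comp_assoc)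
  show ?thesis
    unfolding is_coeffs_def using expansion conj sym by auto
qed

section \<open>Uniqueness of the coefficients\<close>

text \<open>
  Any group of roots of unity on which \<open>1\<close>, \<open>z\<close> and \<open>cnj z\<close> are distinct characters would serve to
  separate \<open>u\<close> from its conjugate; the square roots are excluded, as \<open>z = cnj z\<close> on them.
\<close>
definition fourth_roots :: "complex set" where
  "fourth_roots = {1, \<i>, - 1, - \<i>}"

lemma sum_fourth_roots: "(\<Sum>z\<in>fourth_roots. f z) = f 1 + f \<i> + f (- 1) + f (- \<i>)"
  for f :: "complex \<Rightarrow> complex"
  by (simp add: fourth_roots_def complex_eq_iff)

lemma finite_fourth_roots: "finite fourth_roots"
  by (simp add: fourth_roots_def)

lemma sum_fourth_roots_conj_sign: "(\<Sum>z\<in>fourth_roots. conj_sign s z) = 0"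
  by (simp add: sum_fourth_roots conj_sign_def)

lemma fourth_roots_orthogonality:
  assumes "s \<in> {-1, 1}" "t \<in> {-1, 1}"
  shows "(\<Sum>z\<in>fourth_roots. conj_sign (- s) z * conj_sign t z) = (if s = t then 4 else 0)"
  using assms by (auto simp: sum_fourth_roots conj_sign_def)

lemma conj_sign_zero [simp]: "conj_sign s 0 = 0"
  by (simp add: conj_sign_def)

lemma conj_sign_sum: "conj_sign s (\<Sum>i\<in>A. f i) = (\<Sum>i\<in>A. conj_sign s (f i))"
  by (simp add: conj_sign_def)

text \<open>
  The unnormalised Fourier coefficient at the character \<open>\<tau>\<close> of the monomial in \<open>\<zeta>\<close> in which the factor \<open>j\<close> uses the
  variable with index \<open>x j\<close>.  The sum factors over the variables.  If \<open>x\<close> misses the index \<open>i\<close>, the factor at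
  \<open>i\<close> is the sum of a nontrivial character, hence zero.  Otherwise \<open>x\<close> is a
  permutation, every variable occurs exactly once, and orthogonality of the characters \<open>z\<close> and \<open>cnj z\<close>
  forces the signs to agree.
\<close>
lemma fourth_roots_tuple_sum:
  assumes \<tau>: "\<tau> \<in> sign_tuples r" and \<sigma>: "\<sigma> \<in> sign_tuples r" and x: "x \<in> {..<r} \<rightarrow>\<^sub>E {..<r}"
  shows "(\<Sum>\<zeta>\<in>{..<r} \<rightarrow>\<^sub>E fourth_roots.
            (\<Prod>i<r. conj_sign (- \<tau> i) (\<zeta> i)) * (\<Prod>j<r. conj_sign (\<sigma> j) (\<zeta> (x j)))) =
         (if x ` {..<r} = {..<r} \<and> \<sigma> = (\<lambda>j\<in>{..<r}. \<tau> (x j)) then 4 ^ r else 0)"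
proof -
  \<comment> \<open>the part of the summand that depends on the variable with index \<open>i\<close>\<close>
  define G where "G i z = conj_sign (- \<tau> i) z * (\<Prod>j | j \<in> {..<r} \<and> x j = i. conj_sign (\<sigma> j) z)"
    for i z
  have xr: "x j < r" if "j < r" for j
    using x that by auto
  have "(\<Prod>j<r. conj_sign (\<sigma> j) (\<zeta> (x j))) =
      (\<Prod>i<r. \<Prod>j | j \<in> {..<r} \<and> x j = i. conj_sign (\<sigma> j) (\<zeta> i))" for \<zeta>
  proof -
    have "(\<Prod>j<r. conj_sign (\<sigma> j) (\<zeta> (x j))) =
        (\<Prod>i<r. \<Prod>j | j \<in> {..<r} \<and> x j = i. conj_sign (\<sigma> j) (\<zeta> (x j)))"
      using xr by (intro prod.group[symmetric]) auto
    also have "\<dots> = (\<Prod>i<r. \<Prod>j | j \<in> {..<r} \<and> x j = i. conj_sign (\<sigma> j) (\<zeta> i))"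
      by (intro prod.cong refl) auto
    finally show ?thesis .
  qed
  then have "(\<Sum>\<zeta>\<in>{..<r} \<rightarrow>\<^sub>E fourth_roots.
            (\<Prod>i<r. conj_sign (- \<tau> i) (\<zeta> i)) * (\<Prod>j<r. conj_sign (\<sigma> j) (\<zeta> (x j))))
      = (\<Sum>\<zeta>\<in>{..<r} \<rightarrow>\<^sub>E fourth_roots. \<Prod>i<r. G i (\<zeta> i))"
    by (simp add: G_def prod.distrib)
  also have "\<dots> = (\<Prod>i<r. \<Sum>z\<in>fourth_roots. G i z)"
    by (rule prod_sum_PiE[symmetric]) (auto simp: finite_fourth_roots)
  also have "\<dots> = (if x ` {..<r} = {..<r} \<and> \<sigma> = (\<lambda>j\<in>{..<r}. \<tau> (x j)) then 4 ^ r else 0)"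
  proof (cases "x ` {..<r} = {..<r}")
    case False
    with xr obtain i where i: "i < r" "i \<notin> x ` {..<r}" by blast
    then have empty: "{j \<in> {..<r}. x j = i} = {}" by auto
    have "(\<Sum>z\<in>fourth_roots. G i z) = 0"
      by (simp only: G_def empty) (simp add: sum_fourth_roots_conj_sign)
    with i False show ?thesis
      by (auto simp: prod_zero_iff)
  next
    case True
    then have inj: "inj_on x {..<r}"
      by (intro eq_card_imp_inj_on) auto
    have "(\<Prod>i<r. \<Sum>z\<in>fourth_roots. G i z) = (\<Prod>j<r. \<Sum>z\<in>fourth_roots. G (x j) z)"
      using prod.reindex[OF inj, of "\<lambda>i. \<Sum>z\<in>fourth_roots. G i z"] True by simp
    also have "\<dots> = (\<Prod>j<r. if \<tau> (x j) = \<sigma> j then 4 else 0)"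
    proof (rule prod.cong[OF refl])
      fix j assume j: "j \<in> {..<r}"
      then have "{j' \<in> {..<r}. x j' = x j} = {j}"
        using inj by (auto dest: inj_onD)
      then have "(\<Sum>z\<in>fourth_roots. G (x j) z)
          = (\<Sum>z\<in>fourth_roots. conj_sign (- \<tau> (x j)) z * conj_sign (\<sigma> j) z)"
        by (simp add: G_def)
      also have "\<dots> = (if \<tau> (x j) = \<sigma> j then 4 else 0)"
        using j xr[of j] \<tau> \<sigma> by (intro fourth_roots_orthogonality) (auto simp: sign_tuples_def)
      finally show "(\<Sum>z\<in>fourth_roots. G (x j) z) = (if \<tau> (x j) = \<sigma> j then 4 else 0)" .
    qed
    also have "\<dots> = (if \<sigma> = (\<lambda>j\<in>{..<r}. \<tau> (x j)) then 4 ^ r else 0)"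
    proof (cases "\<forall>j<r. \<sigma> j = \<tau> (x j)")
      case True
      then have "\<sigma> = (\<lambda>j\<in>{..<r}. \<tau> (x j))"
        using \<sigma> by (intro extensionalityI[of _ "{..<r}"]) (auto simp: sign_tuples_def PiE_iff)
      with True show ?thesis by simp
    next
      case False
      then obtain j where "j < r" "\<sigma> j \<noteq> \<tau> (x j)" by blast
      then have "(\<Prod>j<r. if \<tau> (x j) = \<sigma> j then 4 else 0 :: complex) = 0"
        by (intro prod_zero) (auto intro!: bexI[of _ j])
      moreover have "\<sigma> \<noteq> (\<lambda>j\<in>{..<r}. \<tau> (x j))"
        using \<open>j < r\<close> \<open>\<sigma> j \<noteq> \<tau> (x j)\<close> by auto
      ultimately show ?thesis by simp
    qed
    finally show ?thesis using True by simp
  qed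
  finally show ?thesis .
qed

text \<open>
  At a family supported on the modes \<open>\<kappa> 0, \<dots>, \<kappa> (r - 1)\<close> the polynomial becomes one in the
  amplitudes \<open>\<zeta>\<close> and their conjugates.  The modes \<open>\<kappa> i\<close> may coincide, so terms are indexed by the maps \<open>x\<close> that
  choose an amplitude for every factor, and not by the tuples of modes.
\<close>
lemma sum_at_test_family:
  assumes \<kappa>: "\<kappa> \<in> mode_tuples M r"
  shows "(\<Sum>k\<in>mode_tuples M r. e k *
            (\<Prod>j<r. conj_sign (\<sigma> j) (entry (\<Sum>i<r. Poly_Mapping.single (\<kappa> i) (\<zeta> i)) (k j)))) =
         (\<Sum>x\<in>{..<r} \<rightarrow>\<^sub>E {..<r}. e (\<lambda>j\<in>{..<r}. \<kappa> (x j)) * (\<Prod>j<r. conj_sign (\<sigma> j) (\<zeta> (x j))))"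
proof -
  let ?X = "{..<r} \<rightarrow>\<^sub>E {..<r}"
  have expand: "(\<Prod>j<r. conj_sign (\<sigma> j) (entry (\<Sum>i<r. Poly_Mapping.single (\<kappa> i) (\<zeta> i)) (k j)))
      = (\<Sum>x\<in>?X. if k = (\<lambda>j\<in>{..<r}. \<kappa> (x j)) then \<Prod>j<r. conj_sign (\<sigma> j) (\<zeta> (x j)) else 0)"
    if k: "k \<in> mode_tuples M r" for k
  proof -
    have "(\<Prod>j<r. conj_sign (\<sigma> j) (entry (\<Sum>i<r. Poly_Mapping.single (\<kappa> i) (\<zeta> i)) (k j)))
        = (\<Prod>j<r. \<Sum>i<r. if \<kappa> i = k j then conj_sign (\<sigma> j) (\<zeta> i) else 0)"
      by (simp add: lookup_sum lookup_single when_def conj_sign_sum if_distrib[of "conj_sign _"]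
          cong: if_cong)
    also have "\<dots> = (\<Sum>x\<in>?X. \<Prod>j<r. if \<kappa> (x j) = k j then conj_sign (\<sigma> j) (\<zeta> (x j)) else 0)"
      by (rule prod_sum_PiE) auto
    also have "\<dots> = (\<Sum>x\<in>?X. if k = (\<lambda>j\<in>{..<r}. \<kappa> (x j))
                       then \<Prod>j<r. conj_sign (\<sigma> j) (\<zeta> (x j)) else 0)"
    proof (rule sum.cong[OF refl])
      fix x
      show "(\<Prod>j<r. if \<kappa> (x j) = k j then conj_sign (\<sigma> j) (\<zeta> (x j)) else 0)
        = (if k = (\<lambda>j\<in>{..<r}. \<kappa> (x j)) then \<Prod>j<r. conj_sign (\<sigma> j) (\<zeta> (x j)) else 0)"
      proof (cases "\<forall>j<r. \<kappa> (x j) = k j")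
        case True
        then have "k = (\<lambda>j\<in>{..<r}. \<kappa> (x j))"
          using k by (intro extensionalityI[of _ "{..<r}"]) (auto simp: mode_tuples_def PiE_iff)
        with True show ?thesis by simp
      next
        case False
        then obtain j where j: "j < r" "\<kappa> (x j) \<noteq> k j" by blast
        then have "(\<Prod>j<r. if \<kappa> (x j) = k j then conj_sign (\<sigma> j) (\<zeta> (x j)) else 0) = 0"
          by (intro prod_zero) (auto intro!: bexI[of _ j])
        moreover have "k \<noteq> (\<lambda>j\<in>{..<r}. \<kappa> (x j))" using j by auto
        ultimately show ?thesis by simp
      qed
    qed
    finally show ?thesis .
  qed
  have mem: "(\<lambda>j\<in>{..<r}. \<kappa> (x j)) \<in> mode_tuples M r" if "x \<in> ?X" for x
    using that \<kappa> by (auto simp: mode_tuples_def PiE_iff)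
  have "(\<Sum>k\<in>mode_tuples M r. e k *
            (\<Prod>j<r. conj_sign (\<sigma> j) (entry (\<Sum>i<r. Poly_Mapping.single (\<kappa> i) (\<zeta> i)) (k j))))
      = (\<Sum>k\<in>mode_tuples M r. \<Sum>x\<in>?X. if k = (\<lambda>j\<in>{..<r}. \<kappa> (x j))
            then e k * (\<Prod>j<r. conj_sign (\<sigma> j) (\<zeta> (x j))) else 0)"
    by (rule sum.cong[OF refl])
       (simp add: expand sum_distrib_left if_distrib[of "\<lambda>y. _ * y"] cong: if_cong)
  also have "\<dots> = (\<Sum>x\<in>?X. \<Sum>k\<in>mode_tuples M r. if k = (\<lambda>j\<in>{..<r}. \<kappa> (x j))
            then e k * (\<Prod>j<r. conj_sign (\<sigma> j) (\<zeta> (x j))) else 0)"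
    by (rule sum.swap)
  also have "\<dots> = (\<Sum>x\<in>?X. e (\<lambda>j\<in>{..<r}. \<kappa> (x j)) * (\<Prod>j<r. conj_sign (\<sigma> j) (\<zeta> (x j))))"
    by (rule sum.cong[OF refl]) (simp add: finite_mode_tuples mem)
  finally show ?thesis .
qed

text \<open>
  Polarization and the separation of \<open>u\<close> from its conjugate in one step.  Evaluate at the
  families with amplitudes \<open>\<zeta> i\<close> at the modes \<open>\<kappa> i\<close> and take the Fourier coefficient at \<open>\<tau>\<close> over all tuples
  of fourth roots of unity.  Only the terms in which the maps \<open>x\<close> are permutations survive, and by symmetry
  each of them contributes \<open>4 ^ r * e \<tau> \<kappa>\<close>.
\<close>
lemma symmetric_coefficients_eq_0:
  assumes sym: "\<And>\<sigma> k p. \<sigma> \<in> sign_tuples r \<Longrightarrow> k \<in> mode_tuples M r \<Longrightarrow> p permutes {..<r} \<Longrightarrow>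
      e (\<sigma> \<circ> p) (k \<circ> p) = e \<sigma> k"
    and vanish: "\<And>u. u \<in> families M \<Longrightarrow> (\<Sum>\<sigma>\<in>sign_tuples r. \<Sum>k\<in>mode_tuples M r.
      e \<sigma> k * (\<Prod>j<r. conj_sign (\<sigma> j) (entry u (k j)))) = 0"
    and \<tau>: "\<tau> \<in> sign_tuples r" and \<kappa>: "\<kappa> \<in> mode_tuples M r"
  shows "e \<tau> \<kappa> = 0"
proof -
  let ?X = "{..<r} \<rightarrow>\<^sub>E {..<r}" and ?Z = "{..<r} \<rightarrow>\<^sub>E fourth_roots"
  let ?B = "{x \<in> ?X. x ` {..<r} = {..<r}}"
  let ?w = "\<lambda>\<zeta>. \<Prod>i<r. conj_sign (- \<tau> i) (\<zeta> i)"
  let ?E = "\<lambda>\<sigma> x. e \<sigma> (\<lambda>j\<in>{..<r}. \<kappa> (x j))"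
  have sum0: "(\<Sum>\<sigma>\<in>sign_tuples r. \<Sum>x\<in>?X. ?E \<sigma> x * (\<Prod>j<r. conj_sign (\<sigma> j) (\<zeta> (x j)))) = 0" for \<zeta>
  proof -
    have "Poly_Mapping.single (\<kappa> i) (\<zeta> i) \<in> families M" if "i < r" for i
    proof -
      have "\<kappa> i \<in> modes M" using \<kappa> that by (auto simp: mode_tuples_def)
      then show ?thesis by (auto simp: mem_families_iff lookup_single when_def)
    qed
    then have "(\<Sum>i<r. Poly_Mapping.single (\<kappa> i) (\<zeta> i)) \<in> families M"
      by (intro subspace_sum[OF subspace_families]) auto
    from vanish[OF this] show ?thesis
      by (simp only: sum_at_test_family[OF \<kappa>])
  qed
  have sym_bij: "?E (\<lambda>j\<in>{..<r}. \<tau> (x j)) x = e \<tau> \<kappa>" if x: "x \<in> ?B" for x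
  proof -
    define p where "p j = (if j < r then x j else j)" for j
    have "p permutes {..<r}"
    proof (rule bij_imp_permutes)
      have "p ` {..<r} = {..<r}" using x by (auto simp: p_def image_iff)
      then show "bij_betw p {..<r} {..<r}"
        by (simp add: bij_betw_def eq_card_imp_inj_on)
    qed (simp add: p_def)
    moreover have "\<tau> \<circ> p = (\<lambda>j\<in>{..<r}. \<tau> (x j))" "\<kappa> \<circ> p = (\<lambda>j\<in>{..<r}. \<kappa> (x j))"
      using \<tau> \<kappa> by (auto simp: p_def fun_eq_iff sign_tuples_def mode_tuples_def PiE_iff extensional_def)
    ultimately show ?thesis using sym[OF \<tau> \<kappa>, of p] by simp
  qed
  have "0 = (\<Sum>\<zeta>\<in>?Z. ?w \<zeta> * (\<Sum>\<sigma>\<in>sign_tuples r. \<Sum>x\<in>?X. ?E \<sigma> x * (\<Prod>j<r. conj_sign (\<sigma> j) (\<zeta> (x j)))))"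
    using sum0 by (intro sum.neutral[symmetric] ballI) simp
  also have "\<dots> = (\<Sum>\<zeta>\<in>?Z. \<Sum>\<sigma>\<in>sign_tuples r. \<Sum>x\<in>?X.
      ?E \<sigma> x * (?w \<zeta> * (\<Prod>j<r. conj_sign (\<sigma> j) (\<zeta> (x j)))))"
    unfolding sum_distrib_left by (intro sum.cong refl) (simp only: mult.left_commute)
  also have "\<dots> = (\<Sum>\<sigma>\<in>sign_tuples r. \<Sum>x\<in>?X. ?E \<sigma> x *
      (\<Sum>\<zeta>\<in>?Z. ?w \<zeta> * (\<Prod>j<r. conj_sign (\<sigma> j) (\<zeta> (x j)))))"
    unfolding sum_distrib_left by (rule sum_swap_innermost[symmetric])
  also have "\<dots> = (\<Sum>\<sigma>\<in>sign_tuples r. \<Sum>x\<in>?X. ?E \<sigma> x *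
      (if x ` {..<r} = {..<r} \<and> \<sigma> = (\<lambda>j\<in>{..<r}. \<tau> (x j)) then 4 ^ r else 0))"
  proof (intro sum.cong refl)
    fix \<sigma> x assume "\<sigma> \<in> sign_tuples r" "x \<in> ?X"
    from fourth_roots_tuple_sum[OF \<tau> this]
    show "?E \<sigma> x * (\<Sum>\<zeta>\<in>?Z. ?w \<zeta> * (\<Prod>j<r. conj_sign (\<sigma> j) (\<zeta> (x j)))) = ?E \<sigma> x *
        (if x ` {..<r} = {..<r} \<and> \<sigma> = (\<lambda>j\<in>{..<r}. \<tau> (x j)) then 4 ^ r else 0)"
      by (rule arg_cong)
  qed
  also have "\<dots> = (\<Sum>x\<in>?X. \<Sum>\<sigma>\<in>sign_tuples r. ?E \<sigma> x *
      (if x ` {..<r} = {..<r} \<and> \<sigma> = (\<lambda>j\<in>{..<r}. \<tau> (x j)) then 4 ^ r else 0))"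
    by (rule sum.swap)
  also have "\<dots> = (\<Sum>x\<in>?X. if x \<in> ?B then 4 ^ r * e \<tau> \<kappa> else 0)"
  proof (rule sum.cong[OF refl])
    fix x assume x: "x \<in> ?X"
    let ?\<tau>x = "\<lambda>j\<in>{..<r}. \<tau> (x j)"
    have mem: "?\<tau>x \<in> sign_tuples r"
      using x \<tau> by (auto simp: sign_tuples_def PiE_iff)
    show "(\<Sum>\<sigma>\<in>sign_tuples r. ?E \<sigma> x *
        (if x ` {..<r} = {..<r} \<and> \<sigma> = ?\<tau>x then 4 ^ r else 0)) =
        (if x \<in> ?B then 4 ^ r * e \<tau> \<kappa> else 0)"
    proof (cases "x ` {..<r} = {..<r}")
      case True
      then have "(\<Sum>\<sigma>\<in>sign_tuples r. ?E \<sigma> x *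
          (if x ` {..<r} = {..<r} \<and> \<sigma> = ?\<tau>x then 4 ^ r else 0))
          = (\<Sum>\<sigma>\<in>sign_tuples r. if \<sigma> = ?\<tau>x then ?E \<sigma> x * 4 ^ r else 0)"
        by (intro sum.cong refl) simp
      also have "\<dots> = ?E ?\<tau>x x * 4 ^ r"
        using mem by (simp only: sum.delta[OF finite_sign_tuples] if_True)
      finally show ?thesis using True x sym_bij[of x] by simp
    next
      case False
      then show ?thesis by (simp only: mem_Collect_eq) simp
    qed
  qed
  also have "\<dots> = (\<Sum>x\<in>?X \<inter> ?B. 4 ^ r * e \<tau> \<kappa>)"
    by (rule sum.inter_restrict[symmetric]) (simp add: finite_PiE)
  also have "?X \<inter> ?B = ?B" by blast
  also have "(\<Sum>x\<in>?B. 4 ^ r * e \<tau> \<kappa>) = of_nat (card ?B) * (4 ^ r * e \<tau> \<kappa>)"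
    by (rule sum_constant)
  finally have zero: "0 = of_nat (card ?B) * (4 ^ r * e \<tau> \<kappa>)" .
  have identity: "(\<lambda>j\<in>{..<r}. j) \<in> ?B"
    by (rule CollectI, rule conjI) (simp_all add: restrict_PiE image_restrict_eq)
  have fin: "finite ?B"
    by (rule finite_subset[of _ ?X]) (blast, simp add: finite_PiE)
  have "card ?B \<noteq> 0"
  proof
    assume "card ?B = 0"
    then have "?B = {}" by (rule iffD1[OF card_0_eq[OF fin]])
    with identity show False by (simp only: empty_iff)
  qed
  moreover have "(4 :: complex) ^ r \<noteq> 0" by simp
  ultimately show ?thesis using zero[symmetric] by (simp only: mult_eq_0_iff of_nat_eq_0_iff) blast
qed

lemma is_coeffs_unique:
  assumes c: "is_coeffs M r H c" and c': "is_coeffs M r H c'"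
  shows "c = c'"
proof (intro ext)
  fix \<sigma> k
  show "c \<sigma> k = c' \<sigma> k"
  proof (cases "\<sigma> \<in> sign_tuples r \<and> k \<in> mode_tuples M r")
    case True
    have "c \<sigma> k - c' \<sigma> k = 0"
    proof (rule symmetric_coefficients_eq_0[where e = "\<lambda>\<sigma> k. c \<sigma> k - c' \<sigma> k" and r = r and M = M])
      fix u assume "u \<in> families M"
      then show "(\<Sum>\<sigma>\<in>sign_tuples r. \<Sum>k\<in>mode_tuples M r.
          (c \<sigma> k - c' \<sigma> k) * (\<Prod>j<r. conj_sign (\<sigma> j) (entry u (k j)))) = 0"
        using c c' unfolding is_coeffs_def by (simp add: left_diff_distrib sum_subtractf)
    qed (use c c' True in \<open>simp_all add: is_coeffs_def\<close>)
    then show ?thesis by simp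
  next
    case False
    then show ?thesis using c c' by (simp add: is_coeffs_def)
  qed
qed

lemma is_coeffs_coeffs_of:
  assumes "H \<in> hom_poly M r"
  shows "is_coeffs M r H (coeffs_of M r H)"
proof -
  obtain d where d:
    "\<And>\<sigma> k. \<sigma> \<in> sign_tuples r \<Longrightarrow> d (\<lambda>j\<in>{..<r}. - \<sigma> j) k = cnj (d \<sigma> k)"
    "\<And>u. u \<in> families M \<Longrightarrow> complex_of_real (H u) =
       (\<Sum>\<sigma>\<in>sign_tuples r. \<Sum>k\<in>mode_tuples M r.
          d \<sigma> k * (\<Prod>j<r. conj_sign (\<sigma> j) (entry u (k j))))"
    using hom_poly_as_conj_sign_polynomial[OF assms] by blast
  have "\<exists>c. is_coeffs M r H c"
    by (rule exI, rule is_coeffs_symmetrization, erule d(1), erule d(2))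
  then obtain c where c: "is_coeffs M r H c" ..
  show ?thesis
    unfolding coeffs_of_def by (rule theI[of "is_coeffs M r H", OF c]) (rule is_coeffs_unique[OF _ c])
qed

section \<open>Smoothness and the derivative\<close>
lemma hom_poly_smooth_map_on:
  assumes "H \<in> hom_poly M r"
  shows "smooth_map_on (families M) H"
proof -
  obtain a where a: "\<And>u. u \<in> families M \<Longrightarrow> H u = (\<Sum>(\<alpha>, \<beta>)\<in>real_exponents M r.
      a \<alpha> \<beta> * (\<Prod>k\<in>modes M. Re (entry u k) ^ \<alpha> k * Im (entry u k) ^ \<beta> k))"
    using assms by (auto simp: hom_poly_def)
  have "real_polynomial_function (\<lambda>u. Re (entry u k))"
    "real_polynomial_function (\<lambda>u. Im (entry u k))" for k
    by (intro real_polynomial_function.intros(1) bounded_linear_compose[OF bounded_linear_Re]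
        bounded_linear_compose[OF bounded_linear_Im] bounded_linear_entry)+
  then have "real_polynomial_function (\<lambda>u. \<Sum>(\<alpha>, \<beta>)\<in>real_exponents M r.
      a \<alpha> \<beta> * (\<Prod>k\<in>modes M. Re (entry u k) ^ \<alpha> k * Im (entry u k) ^ \<beta> k))"
    unfolding case_prod_unfold
    by (intro real_polynomial_function_sum real_polynomial_function_prod finite_real_exponents
        finite_modes real_polynomial_function.intros(2,4) real_polynomial_function_power)
  then show ?thesis
    using a by (rule real_polynomial_function_smooth_map_on[OF subspace_families])
qed

lemma bounded_linear_conj_sign: "bounded_linear (conj_sign s)"
  unfolding conj_sign_def[abs_def]
  by (cases "s = 1") (simp_all add: bounded_linear_ident bounded_linear_cnj)

lemma norm_conj_sign [simp]: "cmod (conj_sign s z) = cmod z"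
  by (simp add: conj_sign_def)

lemma is_coeffs_has_derivative:
  assumes c: "is_coeffs M r H c" and u: "u \<in> families M"
  shows "(H has_derivative
      (\<lambda>v. Re (\<Sum>\<sigma>\<in>sign_tuples r. \<Sum>k\<in>mode_tuples M r. c \<sigma> k *
          (\<Sum>i<r. conj_sign (\<sigma> i) (entry v (k i)) *
             (\<Prod>j\<in>{..<r} - {i}. conj_sign (\<sigma> j) (entry u (k j))))))) (at u within families M)"
proof (rule has_derivative_transform[OF u])
  show "H x = Re (\<Sum>\<sigma>\<in>sign_tuples r. \<Sum>k\<in>mode_tuples M r.
          c \<sigma> k * (\<Prod>j<r. conj_sign (\<sigma> j) (entry x (k j))))" if "x \<in> families M" for x
  proof -
    have "complex_of_real (H x) = (\<Sum>\<sigma>\<in>sign_tuples r. \<Sum>k\<in>mode_tuples M r.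
          c \<sigma> k * (\<Prod>j<r. conj_sign (\<sigma> j) (entry x (k j))))"
      using c that unfolding is_coeffs_def by blast
    from arg_cong[OF this, of Re] show ?thesis by (simp only: Re_complex_of_real)
  qed
  show "((\<lambda>x. Re (\<Sum>\<sigma>\<in>sign_tuples r. \<Sum>k\<in>mode_tuples M r.
          c \<sigma> k * (\<Prod>j<r. conj_sign (\<sigma> j) (entry x (k j))))) has_derivative
      (\<lambda>v. Re (\<Sum>\<sigma>\<in>sign_tuples r. \<Sum>k\<in>mode_tuples M r. c \<sigma> k *
          (\<Sum>i<r. conj_sign (\<sigma> i) (entry v (k i)) *
             (\<Prod>j\<in>{..<r} - {i}. conj_sign (\<sigma> j) (entry u (k j))))))) (at u within families M)"
    by (intro bounded_linear.has_derivative[OF bounded_linear_Re] has_derivative_sum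
        has_derivative_mult_right has_derivative_prod bounded_linear_imp_has_derivative
        bounded_linear_compose[OF bounded_linear_conj_sign] bounded_linear_entry)
qed

section \<open>The estimate\<close>
lemma japanese_ge_1: "\<langle>y\<rangle> \<ge> 1"
  by (simp add: japanese_def)

lemma japanese_pos: "\<langle>y\<rangle> > 0"
  using japanese_ge_1[of y] by linarith

text \<open>
  The degree \<open>l\<close> contributes \<open>(2 * l + 1) / (1 + l\<^sup>2)\<close>, which is at most \<open>3 / l\<close> for \<open>l \<ge> 1\<close>, so the sum
  is at most \<open>1 + 3 * (1 + ln M)\<close>.  As \<open>M \<ge> 2\<close>, \<open>ln M\<close> is at least 1/2 and absorbs the constant \<open>4\<close>.
\<close>
lemma sum_inverse_japanese_squared_le:
  assumes M: "M \<ge> 2"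
  shows "(\<Sum>k\<in>modes M. (1 / \<langle>real (fst k)\<rangle>)\<^sup>2) \<le> 11 * ln M"
proof -
  define n where "n = nat \<lfloor>M\<rfloor>"
  have n: "n \<ge> 1" "real n \<le> M"
    using M by (auto simp: n_def le_nat_floor)
  have "l \<le> n \<longleftrightarrow> real l \<le> M" for l
    using M by (simp add: n_def le_nat_iff le_floor_iff)
  then have modes: "modes M = Sigma {..n} (\<lambda>l. {- int l..int l})"
    by (auto simp: modes_def)
  have "(\<Sum>k\<in>modes M. (1 / \<langle>real (fst k)\<rangle>)\<^sup>2) = (\<Sum>l\<le>n. \<Sum>m\<in>{- int l..int l}. (1 / \<langle>real l\<rangle>)\<^sup>2)"
    unfolding modes by (subst sum.Sigma) (auto simp: case_prod_unfold)
  also have "\<dots> = (\<Sum>l\<le>n. (2 * real l + 1) / (1 + (real l)\<^sup>2))"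
    by (intro sum.cong) (auto simp: japanese_def power_divide)
  also have "\<dots> = 1 + (\<Sum>l=1..n. (2 * real l + 1) / (1 + (real l)\<^sup>2))"
    by (simp add: sum.atLeast1_atMost_eq sum.atMost_shift lessThan_Suc_atMost)
  also have "(\<Sum>l=1..n. (2 * real l + 1) / (1 + (real l)\<^sup>2)) \<le> (\<Sum>l=1..n. 3 * inverse (real l))"
  proof (rule sum_mono)
    fix l assume l: "l \<in> {1..n}"
    then have "real l \<le> (real l)\<^sup>2" by (simp add: power2_eq_square)
    then have "(2 * real l + 1) * real l \<le> 3 * (1 + (real l)\<^sup>2)"
      by (simp add: algebra_simps power2_eq_square)
    then show "(2 * real l + 1) / (1 + (real l)\<^sup>2) \<le> 3 * inverse (real l)"
      using l add_pos_nonneg[OF zero_less_one, of "(real l)\<^sup>2"]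
      by (simp add: inverse_eq_divide pos_divide_le_eq pos_le_divide_eq)
  qed
  also have "\<dots> = 3 * harm n"
    by (simp add: harm_def sum_distrib_left)
  also have "harm n \<le> 1 + ln (real n)"
    using euler_mascheroni_sequence_decreasing[of 1 n] n by (simp add: harm_expand)
  also have "ln (real n) \<le> ln M"
    using n M by simp
  also have "1 + 3 * (1 + ln M) \<le> 11 * ln M"
  proof -
    have "ln M \<ge> ln 2" using M by simp
    moreover have "ln 2 \<ge> (1 / 2 :: real)"
      using ln2_ge_two_thirds by simp
    ultimately show ?thesis by simp
  qed
  finally show ?thesis by simp
qed

text \<open>
  Cauchy-Schwarz after splitting the weight \<open>\<langle>l\<rangle> powr (-1/2)\<close> into \<open>1 / \<langle>l\<rangle>\<close> and \<open>\<langle>l\<rangle> powr (1/2)\<close>.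
  This is the source of one factor \<open>(ln M) powr (1/2)\<close> for each slot.
\<close>
lemma sum_weighted_entries_le:
  assumes M: "M \<ge> 2"
  shows "(\<Sum>k\<in>modes M. cmod (entry w k) / sqrt \<langle>real (fst k)\<rangle>) \<le> sqrt (11 * ln M) * h_norm M (1 / 2) w"
proof -
  let ?f = "\<lambda>k. 1 / \<langle>real (fst k)\<rangle>" and ?g = "\<lambda>k. sqrt \<langle>real (fst k)\<rangle> * cmod (entry w k)"
  have "cmod (entry w k) / sqrt \<langle>real (fst k)\<rangle> = \<bar>?f k\<bar> * \<bar>?g k\<bar>" for k :: "nat \<times> int"
    using japanese_pos[of "real (fst k)"] by (simp add: field_simps abs_mult)
  then have "(\<Sum>k\<in>modes M. cmod (entry w k) / sqrt \<langle>real (fst k)\<rangle>) = (\<Sum>k\<in>modes M. \<bar>?f k\<bar> * \<bar>?g k\<bar>)"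
    by simp
  also have "\<dots> \<le> L2_set ?f (modes M) * L2_set ?g (modes M)"
    by (rule L2_set_mult_ineq)
  also have "L2_set ?g (modes M) = h_norm M (1 / 2) w"
    using japanese_pos by (simp add: L2_set_def h_norm_def power_mult_distrib less_imp_le)
  also have "L2_set ?f (modes M) \<le> sqrt (11 * ln M)"
    unfolding L2_set_def by (rule real_sqrt_le_mono) (rule sum_inverse_japanese_squared_le[OF M])
  finally show ?thesis
    by (simp add: h_norm_def mult_right_mono sum_nonneg)
qed

lemma sqrt_prod: "sqrt (\<Prod>i\<in>A. f i) = (\<Prod>i\<in>A. sqrt (f i))"
  by (induction A rule: infinite_finite_induct) (simp_all add: real_sqrt_mult)

text \<open>
  The bound on the coefficients is a product over the slots, so that the sum over tuples becomes a
  product of sums.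
\<close>
lemma multilinear_sum_le:
  assumes "\<And>k. k \<in> mode_tuples M r \<Longrightarrow> cmod (c k) * sqrt (\<Prod>j<r. \<langle>real (fst (k j))\<rangle>) \<le> N"
  shows "(\<Sum>k\<in>mode_tuples M r. cmod (c k) * (\<Prod>j<r. cmod (entry (w j) (k j))))
    \<le> N * (\<Prod>j<r. \<Sum>k\<in>modes M. cmod (entry (w j) k) / sqrt \<langle>real (fst k)\<rangle>)"
proof -
  have "(\<Sum>k\<in>mode_tuples M r. cmod (c k) * (\<Prod>j<r. cmod (entry (w j) (k j))))
    \<le> (\<Sum>k\<in>mode_tuples M r. N * (\<Prod>j<r. cmod (entry (w j) (k j)) / sqrt \<langle>real (fst (k j))\<rangle>))"
  proof (rule sum_mono)
    fix k assume k: "k \<in> mode_tuples M r"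
    let ?p = "\<Prod>j<r. sqrt \<langle>real (fst (k j))\<rangle>"
    have p: "?p > 0" by (intro prod_pos) (simp add: japanese_pos)
    have "cmod (c k) * ?p \<le> N"
      using assms[OF k] by (simp add: sqrt_prod)
    then have "cmod (c k) \<le> N / ?p"
      using p by (simp add: field_simps)
    then have "cmod (c k) * (\<Prod>j<r. cmod (entry (w j) (k j)))
        \<le> N / ?p * (\<Prod>j<r. cmod (entry (w j) (k j)))"
      by (intro mult_right_mono prod_nonneg) auto
    then show "cmod (c k) * (\<Prod>j<r. cmod (entry (w j) (k j)))
        \<le> N * (\<Prod>j<r. cmod (entry (w j) (k j)) / sqrt \<langle>real (fst (k j))\<rangle>)"
      by (simp add: prod_dividef)
  qed
  also have "\<dots> = N * (\<Prod>j<r. \<Sum>k\<in>modes M. cmod (entry (w j) k) / sqrt \<langle>real (fst k)\<rangle>)"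
    unfolding sum_distrib_left[symmetric] mode_tuples_def
    by (subst prod_sum_PiE) (auto simp: finite_modes)
  finally show ?thesis .
qed

text \<open>
  The left-hand side is one of the numbers whose maximum is the norm of \<open>H\<close>, up to the factor
  \<open>sqrt (Upsilon r k)\<close>, and \<open>Upsilon r k \<ge> 1\<close>.
\<close>
lemma coeffs_of_bound:
  assumes "\<sigma> \<in> sign_tuples r" "k \<in> mode_tuples M r"
  shows "cmod (coeffs_of M r H \<sigma> k) * sqrt (\<Prod>j<r. \<langle>real (fst (k j))\<rangle>) \<le> H_norm M r H"
proof -
  let ?f = "\<lambda>\<sigma> k. cmod (coeffs_of M r H \<sigma> k) * sqrt (\<Prod>j<r. \<langle>real (fst (k j))\<rangle>) * sqrt (Upsilon r k)"
  have "finite {\<langle>real (fst (k j))\<rangle> | j. j < r \<and> (\<forall>j'<r. j' \<noteq> j \<longrightarrow> k j' \<noteq> k j)}"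
    by (rule finite_subset[of _ "(\<lambda>j. \<langle>real (fst (k j))\<rangle>) ` {..<r}"]) auto
  then have "Upsilon r k \<ge> 1"
    unfolding Upsilon_def by (intro Max_ge) auto
  then have "cmod (coeffs_of M r H \<sigma> k) * sqrt (\<Prod>j<r. \<langle>real (fst (k j))\<rangle>) * 1 \<le> ?f \<sigma> k"
    by (intro mult_left_mono mult_nonneg_nonneg real_sqrt_ge_zero prod_nonneg)
       (auto simp: japanese_pos less_imp_le)
  also have "\<dots> \<le> (MAX k\<in>mode_tuples M r. ?f \<sigma> k)"
    using assms(2) by (intro Max_ge) (auto simp: finite_mode_tuples)
  also have "\<dots> \<le> H_norm M r H"
    unfolding H_norm_def
    using assms(1) by (intro Max_ge) (auto simp: finite_sign_tuples)
  finally show ?thesis by simp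
qed

lemma H_norm_nonneg:
  assumes "M \<ge> 0"
  shows "H_norm M r H \<ge> 0"
proof -
  have "(\<lambda>j\<in>{..<r}. 1) \<in> sign_tuples r" "(\<lambda>j\<in>{..<r}. (0, 0)) \<in> mode_tuples M r"
    using assms by (auto simp: sign_tuples_def mode_tuples_def modes_def)
  from coeffs_of_bound[OF this, of H] show ?thesis
    by (rule order_trans[rotated])
       (auto intro!: mult_nonneg_nonneg real_sqrt_ge_zero prod_nonneg simp: japanese_pos less_imp_le)
qed

lemma h_norm_nonneg: "h_norm M s u \<ge> 0"
  by (simp add: h_norm_def sum_nonneg)

lemma directional_derivative_bound:
  fixes H :: "family \<Rightarrow> real" and u v :: family
  assumes M: "M \<ge> 2"
  shows "cmod (\<Sum>\<sigma>\<in>sign_tuples r. \<Sum>k\<in>mode_tuples M r. coeffs_of M r H \<sigma> k *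
          (\<Sum>i<r. conj_sign (\<sigma> i) (entry v (k i)) *
             (\<Prod>j\<in>{..<r} - {i}. conj_sign (\<sigma> j) (entry u (k j)))))
    \<le> 2 ^ r * real r * sqrt (11 * ln M) ^ r * H_norm M r H *
        h_norm M (1 / 2) u ^ (r - 1) * h_norm M (1 / 2) v"
proof -
  let ?c = "coeffs_of M r H" and ?A = "sqrt (11 * ln M)" and ?N = "H_norm M r H"
  let ?S = "\<lambda>w. \<Sum>k\<in>modes M. cmod (entry w k) / sqrt \<langle>real (fst k)\<rangle>"
  let ?B = "?N * (?A ^ r * (h_norm M (1 / 2) v * h_norm M (1 / 2) u ^ (r - 1)))"
  \<comment> \<open>the arguments of the multilinear form when the slot \<open>i\<close> is differentiated\<close>
  define w where "w i j = (if j = i then v else u)" for i j :: nat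
  have split: "(\<Prod>j<r. f (w i j)) = f v * (\<Prod>j\<in>{..<r} - {i}. f u)" if "i < r"
    for i and f :: "family \<Rightarrow> real"
    using that by (subst prod.remove[of _ i]) (auto simp: w_def)
  have prods: "cmod (conj_sign (\<sigma> i) (entry v (k i)) *
             (\<Prod>j\<in>{..<r} - {i}. conj_sign (\<sigma> j) (entry u (k j))))
       = (\<Prod>j<r. cmod (entry (w i j) (k j)))" if "i < r" for i \<sigma> k
    using that by (subst (2) prod.remove[of _ i]) (auto simp: w_def norm_mult prod_norm[symmetric])
  have each: "(\<Sum>k\<in>mode_tuples M r. cmod (?c \<sigma> k) * (\<Prod>j<r. cmod (entry (w i j) (k j)))) \<le> ?B"
    if \<sigma>: "\<sigma> \<in> sign_tuples r" and i: "i < r" for \<sigma> i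
  proof -
    have "(\<Sum>k\<in>mode_tuples M r. cmod (?c \<sigma> k) * (\<Prod>j<r. cmod (entry (w i j) (k j))))
        \<le> ?N * (\<Prod>j<r. ?S (w i j))"
      by (rule multilinear_sum_le) (rule coeffs_of_bound[OF \<sigma>])
    also have "(\<Prod>j<r. ?S (w i j)) \<le> (\<Prod>j<r. ?A * h_norm M (1 / 2) (w i j))"
      by (intro prod_mono conjI sum_weighted_entries_le[OF M] sum_nonneg divide_nonneg_nonneg)
         (auto simp: japanese_pos less_imp_le)
    also have "\<dots> = ?A ^ r * (h_norm M (1 / 2) v * h_norm M (1 / 2) u ^ (r - 1))"
      using split[OF i, of "h_norm M (1 / 2)"] i by (simp add: prod.distrib)
    finally show ?thesis
      using H_norm_nonneg[of M r H] M by (simp add: mult_left_mono)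
  qed
  have "cmod (\<Sum>\<sigma>\<in>sign_tuples r. \<Sum>k\<in>mode_tuples M r. ?c \<sigma> k *
          (\<Sum>i<r. conj_sign (\<sigma> i) (entry v (k i)) *
             (\<Prod>j\<in>{..<r} - {i}. conj_sign (\<sigma> j) (entry u (k j)))))
      \<le> (\<Sum>\<sigma>\<in>sign_tuples r. \<Sum>k\<in>mode_tuples M r. cmod (?c \<sigma> k) *
          (\<Sum>i<r. \<Prod>j<r. cmod (entry (w i j) (k j))))"
  proof (intro sum_norm_le)
    fix \<sigma> k
    have "cmod (\<Sum>i<r. conj_sign (\<sigma> i) (entry v (k i)) *
             (\<Prod>j\<in>{..<r} - {i}. conj_sign (\<sigma> j) (entry u (k j))))
        \<le> (\<Sum>i<r. \<Prod>j<r. cmod (entry (w i j) (k j)))"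
      by (rule sum_norm_le) (simp add: prods)
    then show "cmod (?c \<sigma> k * (\<Sum>i<r. conj_sign (\<sigma> i) (entry v (k i)) *
             (\<Prod>j\<in>{..<r} - {i}. conj_sign (\<sigma> j) (entry u (k j)))))
        \<le> cmod (?c \<sigma> k) * (\<Sum>i<r. \<Prod>j<r. cmod (entry (w i j) (k j)))"
      unfolding norm_mult by (rule mult_left_mono) simp
  qed
  also have "\<dots> = (\<Sum>\<sigma>\<in>sign_tuples r. \<Sum>i<r. \<Sum>k\<in>mode_tuples M r.
          cmod (?c \<sigma> k) * (\<Prod>j<r. cmod (entry (w i j) (k j))))"
    unfolding sum_distrib_left by (rule sum.cong[OF refl]) (rule sum.swap)
  also have "\<dots> \<le> (\<Sum>\<sigma>\<in>sign_tuples r. \<Sum>i<r. ?B)"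
    by (intro sum_mono each) auto
  also have "\<dots> = 2 ^ r * real r * ?A ^ r * ?N * h_norm M (1 / 2) u ^ (r - 1) * h_norm M (1 / 2) v"
    by (simp add: sign_tuples_def card_PiE)
  finally show ?thesis .
qed

text \<open>
  The test vector with entries \<open>g\<^sub>k / \<langle>l\<rangle>\<close> attains the supremum in the duality: both its scalar product with
  \<open>g\<close> and the square of its norm of exponent 1/2 equal the square of the norm of exponent -1/2 of \<open>g\<close>.
\<close>
lemma h_norm_duality:
  assumes "\<And>v. v \<in> families M \<Longrightarrow> scalar_prod M g v \<le> K * h_norm M (1 / 2) v" and "K \<ge> 0"
  shows "h_norm M (- 1 / 2) g \<le> K"
proof -
  define v where "v = family_of M (\<lambda>k. entry g k / complex_of_real \<langle>real (fst k)\<rangle>)"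
  let ?X = "h_norm M (- 1 / 2) g"
  have sq: "?X\<^sup>2 = (\<Sum>k\<in>modes M. (cmod (entry g k))\<^sup>2 / \<langle>real (fst k)\<rangle>)"
    using japanese_pos
    by (simp add: h_norm_def sum_nonneg powr_minus_divide less_imp_le)
  have "scalar_prod M g v = ?X\<^sup>2"
    unfolding scalar_prod_def sq Re_sum
    by (intro sum.cong refl)
       (simp add: v_def entry_family_of complex_mult_cnj cmod_power2)
  moreover have "(h_norm M (1 / 2) v)\<^sup>2 = ?X\<^sup>2"
  proof -
    have "(h_norm M (1 / 2) v)\<^sup>2 = (\<Sum>k\<in>modes M. \<langle>real (fst k)\<rangle> * (cmod (entry v k))\<^sup>2)"
      using japanese_pos by (simp add: h_norm_def sum_nonneg less_imp_le)
    also have "\<dots> = ?X\<^sup>2"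
      unfolding sq using japanese_pos
      by (intro sum.cong refl)
         (simp add: v_def entry_family_of norm_divide power_divide power2_eq_square less_imp_le less_imp_neq[THEN not_sym])
    finally show ?thesis .
  qed
  then have "h_norm M (1 / 2) v = ?X"
    using h_norm_nonneg power2_eq_iff_nonneg by blast
  ultimately have "?X * ?X \<le> K * ?X"
    using assms(1)[of v] by (simp add: v_def family_of_in_families power2_eq_square)
  then show ?thesis
    using assms(2) h_norm_nonneg[of M "- 1 / 2" g]
    by (cases "?X = 0") (auto simp: mult_le_cancel_right)
qed

theorem lemma4p5:
  fixes r :: nat
  assumes "r \<ge> 2"
  shows "\<exists>C::real. C > 0 \<and>
    (\<forall>M::real. M \<ge> 2 \<longrightarrow>
      (\<forall>H\<in>hom_poly M r.
         smooth_map_on (families M) H \<and>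
         (\<forall>u\<in>families M.
            h_norm M (- 1 / 2) (gradient M H u)
              \<le> C * ln M powr (real r / 2) * H_norm M r H * h_norm M (1 / 2) u ^ (r - 1))))"
proof (intro exI[of _ "2 ^ r * real r * 11 powr (real r / 2)"] conjI allI impI ballI)
  show "2 ^ r * real r * 11 powr (real r / 2) > 0"
    using assms by simp
next
  fix M :: real and H assume "H \<in> hom_poly M r"
  then show "smooth_map_on (families M) H" by (rule hom_poly_smooth_map_on)
next
  fix M :: real and H u
  assume M: "M \<ge> 2" and H: "H \<in> hom_poly M r" and u: "u \<in> families M"
  let ?K = "2 ^ r * real r * sqrt (11 * ln M) ^ r * H_norm M r H * h_norm M (1 / 2) u ^ (r - 1)"
  have "h_norm M (- 1 / 2) (gradient M H u) \<le> ?K"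
  proof (rule h_norm_duality[where M = M])
    fix v assume v: "v \<in> families M"
    show "scalar_prod M (gradient M H u) v \<le> ?K * h_norm M (1 / 2) v"
      unfolding gradient_characterization(2)[OF u is_coeffs_has_derivative[OF is_coeffs_coeffs_of[OF H] u] v]
      by (rule order_trans[OF complex_Re_le_cmod directional_derivative_bound[OF M]])
  next
    show "?K \<ge> 0"
      using M H_norm_nonneg[of M r H] h_norm_nonneg by simp
  qed
  also have "sqrt (11 * ln M) ^ r = 11 powr (real r / 2) * ln M powr (real r / 2)"
  proof -
    have pos: "11 * ln M > 0" using M by simp
    then have "sqrt (11 * ln M) ^ r = (11 * ln M) powr (real r / 2)"
      by (simp add: powr_half_sqrt[symmetric] powr_power)
    then show ?thesis using M by (simp add: powr_mult)
  qed
  finally show "h_norm M (- 1 / 2) (gradient M H u)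
      \<le> 2 ^ r * real r * 11 powr (real r / 2) * ln M powr (real r / 2) * H_norm M r H *
          h_norm M (1 / 2) u ^ (r - 1)"
    by (simp add: mult.assoc)
qed

end
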